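(* Let $\mathcal{A},\mathcal{B}\in\mathbb{C}^{I_1\times\cdots\times I_N\times I_1\times\cdots\times I_N}$, and let $\mathcal{M},\mathcal{N}\in\mathbb{C}^{I_1\times\cdots\times I_N\times I_1\times\cdots\times I_N}$ be Hermitian positive definite tensors. Suppose $\mathcal{M}*_N\mathcal{A}^{\dagger}_{\mathcal{M}\mathcal{N}}=(\mathcal{M}*_N\mathcal{A})^H$. If $$\mathcal{B}*_N(\mathcal{A}^{\dagger}_{\mathcal{M}\mathcal{N}}*_N\mathcal{A})=(\mathcal{A}^{\dagger}_{\mathcal{M}\mathcal{N}}*_N\mathcal{A})*_N\mathcal{B},$$ $$\mathcal{B}^{\dagger}_{\mathcal{M}\mathcal{N}}*_N(\mathcal{A}^{\dagger}_{\mathcal{M}\mathcal{N}}*_N\mathcal{A})=(\mathcal{A}^{\dagger}_{\mathcal{M}\mathcal{N}}*_N\mathcal{A})*_N\mathcal{B}^{\dagger}_{\mathcal{M}\mathcal{N}},$$ then $(\mathcal{A}*_N\mathcal{B})^{\dagger}_{\mathcal{M}\mathcal{N}}=\mathcal{B}^{\dagger}_{\mathcal{M}\mathcal{N}}*_N\mathcal{A}^{\dagger}_{\mathcal{M}\mathcal{N}}$.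
   Context: For tensors $\mathcal{A},\mathcal{B}\in\mathbb{C}^{I_1\times\cdots\times I_N\times I_1\times\cdots\times I_N}$ the Einstein product is $(\mathcal{A}*_N\mathcal{B})_{i_1\cdots i_Nk_1\cdots k_N}=\sum_{j_1,\dots,j_N}a_{i_1\cdots i_Nj_1\cdots j_N}b_{j_1\cdots j_Nk_1\cdots k_N}$. The conjugate transpose is $(\mathcal{A}^H)_{j_1\cdots j_Ni_1\cdots i_N}=\overline{a_{i_1\cdots i_Nj_1\cdots j_N}}$. The identity tensor $\mathcal{I}$ has entries $\prod_{k}\delta_{i_kj_k}$; $\mathcal{U}$ is unitary if $\mathcal{U}*_N\mathcal{U}^H=\mathcal{U}^H*_N\mathcal{U}=\mathcal{I}$; $\mathcal{D}$ is diagonal if $d_{i_1\cdots i_Nj_1\cdots j_N}=0$ whenever $(i_1,\dots,i_N)\ne(j_1,\dots,j_N)$. A tensor $\mathcal{P}$ is Hermitian positive definite if $\mathcal{P}=\mathcal{U}*_N\mathcal{D}*_N\mathcal{U}^H$ with $\mathcal{U}$ unitary and $\mathcal{D}$ diagonal with positive diagonal entries. For Hermitian positive definite $\mathcal{M},\mathcal{N}$, the weighted Moore--Penrose inverse $\mathcal{A}^{\dagger}_{\mathcal{M}\mathcal{N}}$ is the unique tensor $\mathcal{X}\in\mathbb{C}^{I_1\times\cdots\times I_N\times I_1\times\cdots\times I_N}$ satisfying $\mathcal{A}*_N\mathcal{X}*_N\mathcal{A}=\mathcal{A}$, $\mathcal{X}*_N\mathcal{A}*_N\mathcal{X}=\mathcal{X}$,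 $(\mathcal{M}*_N\mathcal{A}*_N\mathcal{X})^H=\mathcal{M}*_N\mathcal{A}*_N\mathcal{X}$, $(\mathcal{N}*_N\mathcal{X}*_N\mathcal{A})^H=\mathcal{N}*_N\mathcal{X}*_N\mathcal{A}$. *)

theory Defs
  imports Complex_Main "HOL-Library.FuncSet"
begin

text \<open>
  An even-order tensor of size \<open>I 1 \<times> \<dots> \<times> I n \<times> I 1 \<times> \<dots> \<times> I n\<close> is a function of a row and a
  column multi-index. Since \<open>n\<close> and \<open>I\<close> are values, not types, the size is enforced by a carrier
  set: members of \<open>tensors n I\<close> are zero off the multi-indices of that size, so that equality of
  tensors is equality of functions.
\<close>

type_synonym multi_index = "nat \<Rightarrow> nat"
type_synonym tensor = "multi_index \<Rightarrow> multi_index \<Rightarrow> complex"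

definition multi_indices :: "nat \<Rightarrow> (nat \<Rightarrow> nat) \<Rightarrow> multi_index set" where
  "multi_indices n I = (\<Pi>\<^sub>E k\<in>{1..n}. {1..I k})"

definition tensors :: "nat \<Rightarrow> (nat \<Rightarrow> nat) \<Rightarrow> tensor set" where
  "tensors n I =
     {A. \<forall>i j. i \<notin> multi_indices n I \<or> j \<notin> multi_indices n I \<longrightarrow> A i j = 0}"

definition einstein_prod :: "nat \<Rightarrow> (nat \<Rightarrow> nat) \<Rightarrow> tensor \<Rightarrow> tensor \<Rightarrow> tensor" where
  "einstein_prod n I A B = (\<lambda>i k. \<Sum>j\<in>multi_indices n I. A i j * B j k)"

abbreviation einstein_prod_syntax :: "tensor \<Rightarrow> nat \<Rightarrow> (nat \<Rightarrow> nat) \<Rightarrow> tensor \<Rightarrow> tensor"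
    ("(_ \<star>\<^bsub>_,_\<^esub> _)" [70, 0, 0, 71] 70) where
  "A \<star>\<^bsub>n,I\<^esub> B \<equiv> einstein_prod n I A B"

definition conj_transpose :: "tensor \<Rightarrow> tensor" ("(_\<^sup>H)" [1000] 999) where
  "A\<^sup>H = (\<lambda>j i. cnj (A i j))"

definition id_tensor :: "nat \<Rightarrow> (nat \<Rightarrow> nat) \<Rightarrow> tensor" where
  "id_tensor n I = (\<lambda>i j.
     if i \<in> multi_indices n I \<and> j \<in> multi_indices n I
     then \<Prod>k\<in>{1..n}. (if i k = j k then 1 else 0) else 0)"

definition unitary_tensor :: "nat \<Rightarrow> (nat \<Rightarrow> nat) \<Rightarrow> tensor \<Rightarrow> bool" where
  "unitary_tensor n I U \<longleftrightarrow>
     U \<in> tensors n I \<and> U \<star>\<^bsub>n,I\<^esub> U\<^sup>H = id_tensor n I \<and> U\<^sup>H \<star>\<^bsub>n,I\<^esub> U = id_tensor n I"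

definition diagonal_tensor :: "nat \<Rightarrow> (nat \<Rightarrow> nat) \<Rightarrow> tensor \<Rightarrow> bool" where
  "diagonal_tensor n I D \<longleftrightarrow>
     D \<in> tensors n I \<and>
     (\<forall>i\<in>multi_indices n I. \<forall>j\<in>multi_indices n I. i \<noteq> j \<longrightarrow> D i j = 0)"

definition hermitian_pos_def :: "nat \<Rightarrow> (nat \<Rightarrow> nat) \<Rightarrow> tensor \<Rightarrow> bool" where
  "hermitian_pos_def n I P \<longleftrightarrow>
     (\<exists>U D. unitary_tensor n I U \<and> diagonal_tensor n I D \<and>
        (\<forall>i\<in>multi_indices n I. D i i \<in> \<real> \<and> Re (D i i) > 0) \<and>
        P = U \<star>\<^bsub>n,I\<^esub> D \<star>\<^bsub>n,I\<^esub> U\<^sup>H)"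

definition is_weighted_MP_inverse ::
    "nat \<Rightarrow> (nat \<Rightarrow> nat) \<Rightarrow> tensor \<Rightarrow> tensor \<Rightarrow> tensor \<Rightarrow> tensor \<Rightarrow> bool" where
  "is_weighted_MP_inverse n I M N A X \<longleftrightarrow>
     X \<in> tensors n I \<and>
     A \<star>\<^bsub>n,I\<^esub> X \<star>\<^bsub>n,I\<^esub> A = A \<and>
     X \<star>\<^bsub>n,I\<^esub> A \<star>\<^bsub>n,I\<^esub> X = X \<and>
     (M \<star>\<^bsub>n,I\<^esub> A \<star>\<^bsub>n,I\<^esub> X)\<^sup>H = M \<star>\<^bsub>n,I\<^esub> A \<star>\<^bsub>n,I\<^esub> X \<and>
     (N \<star>\<^bsub>n,I\<^esub> X \<star>\<^bsub>n,I\<^esub> A)\<^sup>H = N \<star>\<^bsub>n,I\<^esub> X \<star>\<^bsub>n,I\<^esub> A"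

text \<open>Meaningful when \<open>A\<close> is in \<open>tensors n I\<close> and \<open>M\<close>, \<open>N\<close> are Hermitian positive definite.\<close>

definition weighted_MP_inverse ::
    "nat \<Rightarrow> (nat \<Rightarrow> nat) \<Rightarrow> tensor \<Rightarrow> tensor \<Rightarrow> tensor \<Rightarrow> tensor" where
  "weighted_MP_inverse n I M N A = (THE X. is_weighted_MP_inverse n I M N A X)"

abbreviation weighted_MP_inverse_syntax ::
    "tensor \<Rightarrow> nat \<Rightarrow> (nat \<Rightarrow> nat) \<Rightarrow> tensor \<Rightarrow> tensor \<Rightarrow> tensor"
    ("(_\<^sup>\<dagger>\<^bsub>_,_,_,_\<^esub>)" [1000, 0, 0, 0, 0] 999) where
  "A\<^sup>\<dagger>\<^bsub>n,I,M,N\<^esub> \<equiv> weighted_MP_inverse n I M N A"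

end

theory Submission
  imports Defs "HOL-Library.Function_Algebras"
begin

text \<open>
  Existence is the analytic part: \<open>T = A\<^sup>H M A N\<inverse> A\<^sup>H\<close> has some inner inverse \<open>G\<close>, that is
  \<open>T G T = T\<close>, and positivity of the weights allows one to cancel factors \<open>A\<^sup>H M\<close> and \<open>N\<inverse> A\<^sup>H\<close>, so
  that \<open>X = N\<inverse> A\<^sup>H G A\<^sup>H M\<close> satisfies the four Penrose equations. For the reverse order law, the
  hypothesis \<open>M A\<^sup>\<dagger> = A\<^sup>H M\<close> says that \<open>A\<^sup>\<dagger>\<close> is the adjoint of \<open>A\<close> with respect to \<open>M\<close>, which makes
  \<open>A B B\<^sup>\<dagger> A\<^sup>\<dagger>\<close> self-adjoint for \<open>M\<close>, while the commutation hypotheses let the projection \<open>A\<^sup>\<dagger> A\<close>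
  pass through \<open>B\<close> and \<open>B\<^sup>\<dagger>\<close> in the other three equations.
\<close>

section \<open>Algebra of the Einstein product\<close>

lemma finite_multi_indices [simp]: "finite (multi_indices n I)"
  by (simp add: multi_indices_def finite_PiE)

lemma einstein_prod_in_tensors [simp]:
  "A \<in> tensors n I \<Longrightarrow> B \<in> tensors n I \<Longrightarrow> A \<star>\<^bsub>n,I\<^esub> B \<in> tensors n I"
  by (auto simp: tensors_def einstein_prod_def)

lemma conj_transpose_in_tensors [simp]: "A \<in> tensors n I \<Longrightarrow> A\<^sup>H \<in> tensors n I"
  by (auto simp: tensors_def conj_transpose_def)

lemma diff_in_tensors: "A \<in> tensors n I \<Longrightarrow> B \<in> tensors n I \<Longrightarrow> A - B \<in> tensors n I"
  by (auto simp: tensors_def)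

lemma conj_transpose_conj_transpose [simp]: "(A\<^sup>H)\<^sup>H = A"
  by (simp add: conj_transpose_def)

lemma conj_transpose_einstein_prod: "(A \<star>\<^bsub>n,I\<^esub> B)\<^sup>H = B\<^sup>H \<star>\<^bsub>n,I\<^esub> A\<^sup>H"
  by (simp add: conj_transpose_def einstein_prod_def fun_eq_iff mult.commute)

lemma einstein_prod_assoc: "(A \<star>\<^bsub>n,I\<^esub> B) \<star>\<^bsub>n,I\<^esub> C = A \<star>\<^bsub>n,I\<^esub> (B \<star>\<^bsub>n,I\<^esub> C)"
proof (intro ext)
  fix i l
  have "((A \<star>\<^bsub>n,I\<^esub> B) \<star>\<^bsub>n,I\<^esub> C) i l
      = (\<Sum>k\<in>multi_indices n I. \<Sum>j\<in>multi_indices n I. A i j * B j k * C k l)"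
    by (simp add: einstein_prod_def sum_distrib_right)
  also have "\<dots> = (\<Sum>j\<in>multi_indices n I. \<Sum>k\<in>multi_indices n I. A i j * B j k * C k l)"
    by (rule sum.swap)
  also have "\<dots> = (A \<star>\<^bsub>n,I\<^esub> (B \<star>\<^bsub>n,I\<^esub> C)) i l"
    by (simp add: einstein_prod_def sum_distrib_left mult.assoc)
  finally show "((A \<star>\<^bsub>n,I\<^esub> B) \<star>\<^bsub>n,I\<^esub> C) i l = (A \<star>\<^bsub>n,I\<^esub> (B \<star>\<^bsub>n,I\<^esub> C)) i l" .
qed

lemma einstein_prod_diff_right:
  "A \<star>\<^bsub>n,I\<^esub> (B - C) = A \<star>\<^bsub>n,I\<^esub> B - A \<star>\<^bsub>n,I\<^esub> C"
  by (simp add: einstein_prod_def fun_eq_iff right_diff_distrib sum_subtractf)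

lemma einstein_prod_zero_right [simp]: "A \<star>\<^bsub>n,I\<^esub> 0 = 0"
  by (simp add: einstein_prod_def fun_eq_iff)

text \<open>Multi-indices are extensional functions, so two distinct ones differ at some position in
  \<open>{1..n}\<close>, and the factor there annihilates the product of deltas.\<close>

lemma id_tensor_apply:
  "id_tensor n I i j = (if i \<in> multi_indices n I \<and> i = j then 1 else 0)"
proof (cases "i \<in> multi_indices n I \<and> j \<in> multi_indices n I")
  case True
  show ?thesis
  proof (cases "i = j")
    case False
    with True obtain k where "k \<in> {1..n}" "i k \<noteq> j k"
      unfolding multi_indices_def by (metis PiE_ext)
    hence "(\<Prod>k\<in>{1..n}. (if i k = j k then 1 else 0 :: complex)) = 0"
      by (intro prod_zero) auto
    with False show ?thesis
      by (simp add: id_tensor_def)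
  qed (use True in \<open>simp add: id_tensor_def\<close>)
qed (auto simp: id_tensor_def)

lemma id_tensor_in_tensors [simp]: "id_tensor n I \<in> tensors n I"
  by (auto simp: tensors_def id_tensor_apply)

lemma einstein_prod_id_left [simp]: "A \<in> tensors n I \<Longrightarrow> id_tensor n I \<star>\<^bsub>n,I\<^esub> A = A"
proof (intro ext)
  fix i k
  assume A: "A \<in> tensors n I"
  have "(id_tensor n I \<star>\<^bsub>n,I\<^esub> A) i k = (\<Sum>j\<in>multi_indices n I. if j = i then A i k else 0)"
    unfolding einstein_prod_def by (rule sum.cong) (auto simp: id_tensor_apply)
  also have "\<dots> = A i k"
    using A by (auto simp: tensors_def)
  finally show "(id_tensor n I \<star>\<^bsub>n,I\<^esub> A) i k = A i k" .
qed

text \<open>The conjugate transpose of the left law, as the identity tensor is self-adjoint.\<close>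

lemma einstein_prod_id_right [simp]: "A \<in> tensors n I \<Longrightarrow> A \<star>\<^bsub>n,I\<^esub> id_tensor n I = A"
proof -
  assume A: "A \<in> tensors n I"
  have "(id_tensor n I)\<^sup>H = id_tensor n I"
    by (intro ext) (auto simp: conj_transpose_def id_tensor_apply)
  with A show "A \<star>\<^bsub>n,I\<^esub> id_tensor n I = A"
    by (metis conj_transpose_conj_transpose conj_transpose_einstein_prod
        conj_transpose_in_tensors einstein_prod_id_left)
qed

section \<open>Hermitian positive definite tensors: symmetry, inverse, definiteness\<close>

lemma hermitian_pos_def_in_tensors: "hermitian_pos_def n I P \<Longrightarrow> P \<in> tensors n I"
  by (auto simp: hermitian_pos_def_def unitary_tensor_def diagonal_tensor_def)

lemma hermitian_pos_def_conj_transpose: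
  assumes "hermitian_pos_def n I P"
  shows "P\<^sup>H = P"
proof -
  obtain U D where D: "diagonal_tensor n I D" "\<forall>i\<in>multi_indices n I. D i i \<in> \<real>"
    and P: "P = U \<star>\<^bsub>n,I\<^esub> D \<star>\<^bsub>n,I\<^esub> U\<^sup>H"
    using assms unfolding hermitian_pos_def_def by blast
  have "cnj (D i j) = D j i" for i j
  proof (cases "i \<in> multi_indices n I \<and> j \<in> multi_indices n I")
    case True
    thus ?thesis
      using D by (cases "i = j") (auto simp: diagonal_tensor_def Reals_cnj_iff)
  next
    case False
    hence "D i j = 0" "D j i = 0"
      using D by (auto simp: diagonal_tensor_def tensors_def)
    thus ?thesis by simp
  qed
  hence "D\<^sup>H = D"
    by (simp add: conj_transpose_def fun_eq_iff)
  thus ?thesis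
    by (simp add: P conj_transpose_einstein_prod einstein_prod_assoc)
qed

lemma diagonal_einstein_prod:
  assumes "diagonal_tensor n I D" and "i \<in> multi_indices n I"
  shows "(D \<star>\<^bsub>n,I\<^esub> A) i k = D i i * A i k"
proof -
  have "(D \<star>\<^bsub>n,I\<^esub> A) i k = (\<Sum>j\<in>multi_indices n I. if j = i then D i i * A i k else 0)"
    unfolding einstein_prod_def
    by (rule sum.cong) (use assms in \<open>auto simp: diagonal_tensor_def\<close>)
  with assms(2) show ?thesis
    by simp
qed

text \<open>The diagonal factor of the decomposition is inverted and the unitary factor kept.
  Positivity of \<open>Q\<close> matters as well: the inverse of a weight will itself serve as a
  weight.\<close>

lemma hermitian_pos_def_inverse:
  assumes "hermitian_pos_def n I P"
  obtains Q where "hermitian_pos_def n I Q"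
    and "P \<star>\<^bsub>n,I\<^esub> Q = id_tensor n I" and "Q \<star>\<^bsub>n,I\<^esub> P = id_tensor n I"
proof -
  obtain U D where U: "unitary_tensor n I U" and D: "diagonal_tensor n I D"
    and pos: "\<forall>i\<in>multi_indices n I. D i i \<in> \<real> \<and> Re (D i i) > 0"
    and P: "P = U \<star>\<^bsub>n,I\<^esub> D \<star>\<^bsub>n,I\<^esub> U\<^sup>H"
    using assms unfolding hermitian_pos_def_def by blast
  have nz: "D i i \<noteq> 0" if "i \<in> multi_indices n I" for i
    using pos that by fastforce
  \<comment> \<open>Since \<open>inverse 0 = 0\<close>, the entrywise inverse stays zero off the
    diagonal and off the carrier.\<close>
  define E :: tensor where "E = (\<lambda>i j. inverse (D i j))"
  have E: "diagonal_tensor n I E"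
    using D by (auto simp: diagonal_tensor_def E_def tensors_def)
  have Epos: "E i i \<in> \<real> \<and> Re (E i i) > 0" if "i \<in> multi_indices n I" for i
  proof -
    have "D i i \<in> \<real>"
      using pos that by blast
    then obtain r where r: "D i i = of_real r"
      by (rule Reals_cases)
    have "r > 0"
      using pos[rule_format, OF that] r by simp
    moreover have "E i i = of_real (inverse r)"
      unfolding E_def r by (rule of_real_inverse[symmetric])
    ultimately show ?thesis
      by (simp del: of_real_inverse)
  qed
  have Dt: "D \<in> tensors n I" and Et: "E \<in> tensors n I"
    using D E by (auto simp: diagonal_tensor_def)
  have DE: "D \<star>\<^bsub>n,I\<^esub> E = id_tensor n I" "E \<star>\<^bsub>n,I\<^esub> D = id_tensor n I"
  proof -
    have "(D \<star>\<^bsub>n,I\<^esub> E) i k = id_tensor n I i k \<and> (E \<star>\<^bsub>n,I\<^esub> D) i k = id_tensor n I i k" for i k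
    proof (cases "i \<in> multi_indices n I")
      case True
      have "D i k = 0" if "i \<noteq> k"
        using that True D by (auto simp: diagonal_tensor_def tensors_def)
      with True nz[OF True] show ?thesis
        by (auto simp: diagonal_einstein_prod[OF D] diagonal_einstein_prod[OF E]
            id_tensor_apply) (auto simp: E_def)
    next
      case False
      with Dt Et show ?thesis
        by (simp add: einstein_prod_def tensors_def id_tensor_apply)
    qed
    thus "D \<star>\<^bsub>n,I\<^esub> E = id_tensor n I" "E \<star>\<^bsub>n,I\<^esub> D = id_tensor n I"
      by (simp_all add: fun_eq_iff)
  qed
  have Ut: "U \<in> tensors n I" and UU: "U \<star>\<^bsub>n,I\<^esub> U\<^sup>H = id_tensor n I" "U\<^sup>H \<star>\<^bsub>n,I\<^esub> U = id_tensor n I"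
    using U by (auto simp: unitary_tensor_def)
  have conj_prod: "(U \<star>\<^bsub>n,I\<^esub> F \<star>\<^bsub>n,I\<^esub> U\<^sup>H) \<star>\<^bsub>n,I\<^esub> (U \<star>\<^bsub>n,I\<^esub> G \<star>\<^bsub>n,I\<^esub> U\<^sup>H) = id_tensor n I"
    if "F \<star>\<^bsub>n,I\<^esub> G = id_tensor n I" "F \<in> tensors n I" "G \<in> tensors n I" for F G
  proof -
    have "(U \<star>\<^bsub>n,I\<^esub> F \<star>\<^bsub>n,I\<^esub> U\<^sup>H) \<star>\<^bsub>n,I\<^esub> (U \<star>\<^bsub>n,I\<^esub> G \<star>\<^bsub>n,I\<^esub> U\<^sup>H)
        = U \<star>\<^bsub>n,I\<^esub> (F \<star>\<^bsub>n,I\<^esub> ((U\<^sup>H \<star>\<^bsub>n,I\<^esub> U) \<star>\<^bsub>n,I\<^esub> G)) \<star>\<^bsub>n,I\<^esub> U\<^sup>H"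
      by (simp only: einstein_prod_assoc)
    thus ?thesis
      by (simp add: UU that Ut)
  qed
  show thesis
  proof
    show "hermitian_pos_def n I (U \<star>\<^bsub>n,I\<^esub> E \<star>\<^bsub>n,I\<^esub> U\<^sup>H)"
      unfolding hermitian_pos_def_def using U E Epos by blast
    show "P \<star>\<^bsub>n,I\<^esub> (U \<star>\<^bsub>n,I\<^esub> E \<star>\<^bsub>n,I\<^esub> U\<^sup>H) = id_tensor n I"
      unfolding P by (rule conj_prod[OF DE(1) Dt Et])
    show "(U \<star>\<^bsub>n,I\<^esub> E \<star>\<^bsub>n,I\<^esub> U\<^sup>H) \<star>\<^bsub>n,I\<^esub> P = id_tensor n I"
      unfolding P by (rule conj_prod[OF DE(2) Et Dt])
  qed
qed

text \<open>Each diagonal entry of \<open>Z\<^sup>H P Z\<close> is the quadratic form of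
  \<open>P\<close> at one column of \<open>Z\<close>. In the unitary coordinates \<open>W\<close> it
  is a sum of squared moduli with positive weights, so its vanishing forces the column to
  vanish.\<close>

lemma hermitian_pos_def_definite:
  assumes "hermitian_pos_def n I P" and Z: "Z \<in> tensors n I"
    and zero: "Z\<^sup>H \<star>\<^bsub>n,I\<^esub> (P \<star>\<^bsub>n,I\<^esub> Z) = 0"
  shows "Z = 0"
proof -
  obtain U D where U: "unitary_tensor n I U" and D: "diagonal_tensor n I D"
    and pos: "\<forall>i\<in>multi_indices n I. D i i \<in> \<real> \<and> Re (D i i) > 0"
    and P: "P = U \<star>\<^bsub>n,I\<^esub> D \<star>\<^bsub>n,I\<^esub> U\<^sup>H"
    using assms(1) unfolding hermitian_pos_def_def by blast
  have Ut: "U \<in> tensors n I" and UU: "U \<star>\<^bsub>n,I\<^esub> U\<^sup>H = id_tensor n I"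
    using U by (auto simp: unitary_tensor_def)
  define W where "W = U\<^sup>H \<star>\<^bsub>n,I\<^esub> Z"
  have Wt: "W \<in> tensors n I"
    using Ut Z by (simp add: W_def)
  have W0: "W\<^sup>H \<star>\<^bsub>n,I\<^esub> (D \<star>\<^bsub>n,I\<^esub> W) = 0"
    using zero by (simp add: W_def P conj_transpose_einstein_prod einstein_prod_assoc)
  have "W i k = 0" for i k
  proof (cases "i \<in> multi_indices n I")
    case True
    have "0 = Re ((W\<^sup>H \<star>\<^bsub>n,I\<^esub> (D \<star>\<^bsub>n,I\<^esub> W)) k k)"
      by (simp add: W0)
    also have "\<dots> = (\<Sum>j\<in>multi_indices n I. Re (cnj (W j k) * (D j j * W j k)))"
      unfolding einstein_prod_def[of n I "W\<^sup>H"]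
      by (simp add: diagonal_einstein_prod[OF D] conj_transpose_def)
    also have "\<dots> = (\<Sum>j\<in>multi_indices n I. Re (D j j) * (cmod (W j k))\<^sup>2)"
    proof (rule sum.cong)
      fix j assume "j \<in> multi_indices n I"
      then obtain r where "D j j = of_real r"
        using pos by (metis Reals_cases)
      thus "Re (cnj (W j k) * (D j j * W j k)) = Re (D j j) * (cmod (W j k))\<^sup>2"
        by (simp add: cmod_power2) (simp add: algebra_simps power2_eq_square)
    qed simp
    finally have "(\<Sum>j\<in>multi_indices n I. Re (D j j) * (cmod (W j k))\<^sup>2) = 0"
      by simp
    hence "Re (D i i) * (cmod (W i k))\<^sup>2 = 0"
      using pos True by (subst (asm) sum_nonneg_eq_0_iff) auto
    with pos True show ?thesis
      by fastforce
  next
    case False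
    with Wt show ?thesis
      by (simp add: tensors_def)
  qed
  hence "W = 0"
    by (simp add: fun_eq_iff)
  moreover have "Z = U \<star>\<^bsub>n,I\<^esub> W"
    unfolding W_def by (simp add: UU Z flip: einstein_prod_assoc)
  ultimately show ?thesis
    by simp
qed

section \<open>Cancellation of weighted Gram factors\<close>

text \<open>Multiplying the difference of the two sides by \<open>(Z - W)\<^sup>H\<close> on the
  left gives the form of \<open>P\<close> at \<open>A (Z - W)\<close>, which vanishes only if
  \<open>A (Z - W)\<close> does.\<close>

lemma weighted_gram_cancel_left:
  assumes P: "hermitian_pos_def n I P" and A: "A \<in> tensors n I"
    and ZW: "Z \<in> tensors n I" "W \<in> tensors n I"
    and eq: "A\<^sup>H \<star>\<^bsub>n,I\<^esub> (P \<star>\<^bsub>n,I\<^esub> (A \<star>\<^bsub>n,I\<^esub> Z)) = A\<^sup>H \<star>\<^bsub>n,I\<^esub> (P \<star>\<^bsub>n,I\<^esub> (A \<star>\<^bsub>n,I\<^esub> W))"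
  shows "A \<star>\<^bsub>n,I\<^esub> Z = A \<star>\<^bsub>n,I\<^esub> W"
proof -
  have "A \<star>\<^bsub>n,I\<^esub> (Z - W) = 0"
  proof (rule hermitian_pos_def_definite[OF P])
    have "A\<^sup>H \<star>\<^bsub>n,I\<^esub> (P \<star>\<^bsub>n,I\<^esub> (A \<star>\<^bsub>n,I\<^esub> (Z - W))) = 0"
      by (simp add: einstein_prod_diff_right eq)
    thus "(A \<star>\<^bsub>n,I\<^esub> (Z - W))\<^sup>H \<star>\<^bsub>n,I\<^esub> (P \<star>\<^bsub>n,I\<^esub> (A \<star>\<^bsub>n,I\<^esub> (Z - W))) = 0"
      by (simp add: conj_transpose_einstein_prod einstein_prod_assoc)
  qed (simp add: A ZW diff_in_tensors)
  thus ?thesis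
    by (simp add: einstein_prod_diff_right)
qed

text \<open>The conjugate transpose of left cancellation, with \<open>A\<^sup>H\<close> in the role
  of \<open>A\<close>.\<close>

lemma weighted_gram_cancel_right:
  assumes P: "hermitian_pos_def n I P" and A: "A \<in> tensors n I"
    and ZW: "Z \<in> tensors n I" "W \<in> tensors n I"
    and eq: "Z \<star>\<^bsub>n,I\<^esub> (A \<star>\<^bsub>n,I\<^esub> (P \<star>\<^bsub>n,I\<^esub> A\<^sup>H)) = W \<star>\<^bsub>n,I\<^esub> (A \<star>\<^bsub>n,I\<^esub> (P \<star>\<^bsub>n,I\<^esub> A\<^sup>H))"
  shows "Z \<star>\<^bsub>n,I\<^esub> A = W \<star>\<^bsub>n,I\<^esub> A"
proof -
  have "A\<^sup>H \<star>\<^bsub>n,I\<^esub> Z\<^sup>H = A\<^sup>H \<star>\<^bsub>n,I\<^esub> W\<^sup>H"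
  proof (rule weighted_gram_cancel_left[OF P])
    show "(A\<^sup>H)\<^sup>H \<star>\<^bsub>n,I\<^esub> (P \<star>\<^bsub>n,I\<^esub> (A\<^sup>H \<star>\<^bsub>n,I\<^esub> Z\<^sup>H)) = (A\<^sup>H)\<^sup>H \<star>\<^bsub>n,I\<^esub> (P \<star>\<^bsub>n,I\<^esub> (A\<^sup>H \<star>\<^bsub>n,I\<^esub> W\<^sup>H))"
      using arg_cong[OF eq, of conj_transpose]
      by (simp add: conj_transpose_einstein_prod einstein_prod_assoc
          hermitian_pos_def_conj_transpose[OF P])
  qed (use A ZW in simp_all)
  thus ?thesis
    by (metis conj_transpose_conj_transpose conj_transpose_einstein_prod)
qed

section \<open>Inner inverses from linear maps\<close>

text \<open>Tensors are to act on the space of all functions of a multi-index, with pointwise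
  operations. It depends on neither \<open>n\<close> nor \<open>I\<close>, so the type serves as
  carrier.\<close>

interpretation index_fun: vector_space "\<lambda>(c :: complex) (v :: multi_index \<Rightarrow> complex) i. c * v i"
  by unfold_locales (auto simp: fun_eq_iff algebra_simps)

interpretation index_fun_pair: vector_space_pair
  "\<lambda>(c :: complex) (v :: multi_index \<Rightarrow> complex) i. c * v i"
  "\<lambda>(c :: complex) (v :: multi_index \<Rightarrow> complex) i. c * v i"
  by unfold_locales

lemma sum_fun_apply: "(\<Sum>j\<in>S. f j) i = (\<Sum>j\<in>S. f j i)"
  for f :: "'a \<Rightarrow> 'b \<Rightarrow> 'c::comm_monoid_add"
  by (induction S rule: infinite_finite_induct) auto

text \<open>The linear map \<open>f\<close> given by \<open>A\<close> has a linear right inverse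
  \<open>g\<close> on its range, and the matrix of \<open>g\<close> is an inner inverse of
  \<open>A\<close>.\<close>

lemma inner_inverse_exists:
  assumes A: "A \<in> tensors n I"
  obtains G where "G \<in> tensors n I" and "A \<star>\<^bsub>n,I\<^esub> (G \<star>\<^bsub>n,I\<^esub> A) = A"
proof -
  let ?S = "multi_indices n I"
  let ?scale = "\<lambda>(c :: complex) (v :: multi_index \<Rightarrow> complex) i. c * v i"
  define f where "f v = (\<lambda>i. \<Sum>j\<in>?S. A i j * v j)" for v :: "multi_index \<Rightarrow> complex"
  define e :: "multi_index \<Rightarrow> multi_index \<Rightarrow> complex" where "e j = (\<lambda>i. if i = j then 1 else 0)" for j
  have f: "Vector_Spaces.linear ?scale ?scale f"
    by unfold_locales (auto simp: f_def fun_eq_iff algebra_simps sum.distrib sum_distrib_left)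
  obtain g where g: "Vector_Spaces.linear ?scale ?scale g" and fgf: "\<And>v. f (g (f v)) = f v"
    using index_fun_pair.linear_exists_right_inverse_on[OF f index_fun.subspace_UNIV] by auto
  interpret g: Vector_Spaces.linear ?scale ?scale g
    by (rule g)
  \<comment> \<open>Cutting the matrix of \<open>g\<close> down to \<open>?S\<close> loses nothing:
    \<open>f\<close> reads only coordinates in \<open>?S\<close>, and the columns of
    \<open>A\<close> are supported there.\<close>
  define G :: tensor where "G = (\<lambda>i j. if i \<in> ?S \<and> j \<in> ?S then g (e j) i else 0)"
  have fe: "f (e k) = (\<lambda>i. A i k)" if "k \<in> ?S" for k
    using that by (intro ext) (simp add: f_def e_def if_distrib cong: if_cong)
  have gA: "g (\<lambda>i. A i k) i = (G \<star>\<^bsub>n,I\<^esub> A) i k" if "i \<in> ?S" for i k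
  proof -
    \<comment> \<open>Column \<open>k\<close> of \<open>A\<close> is expanded in unit vectors, so
      that linearity of \<open>g\<close> applies.\<close>
    have "(\<lambda>i. A i k) = (\<Sum>j\<in>?S. (\<lambda>i. A j k * e j i))"
      using A by (intro ext) (simp add: sum_fun_apply e_def if_distrib tensors_def cong: if_cong)
    hence "g (\<lambda>i. A i k) = (\<Sum>j\<in>?S. (\<lambda>i. A j k * g (e j) i))"
      by (simp add: g.sum g.scale)
    thus ?thesis
      using that by (simp add: sum_fun_apply einstein_prod_def G_def mult.commute)
  qed
  have "(A \<star>\<^bsub>n,I\<^esub> (G \<star>\<^bsub>n,I\<^esub> A)) i k = A i k" for i k
  proof (cases "k \<in> ?S")
    case True
    have "(A \<star>\<^bsub>n,I\<^esub> (G \<star>\<^bsub>n,I\<^esub> A)) i k = f (g (\<lambda>i. A i k)) i"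
      by (simp add: einstein_prod_def[of n I A] f_def gA)
    also have "\<dots> = A i k"
      using fgf[of "e k"] fe[OF True] by simp
    finally show ?thesis .
  next
    case False
    with A show ?thesis
      by (simp add: einstein_prod_def tensors_def)
  qed
  moreover have "G \<in> tensors n I"
    by (auto simp: G_def tensors_def)
  ultimately show thesis
    by (intro that) (auto simp: fun_eq_iff)
qed

section \<open>Existence of the weighted inverse\<close>

lemma weighted_MP_inverse_exists:
  assumes M: "hermitian_pos_def n I M" and N: "hermitian_pos_def n I N"
    and A: "A \<in> tensors n I"
  obtains X where "is_weighted_MP_inverse n I M N A X"
proof -
  obtain Q where Q: "hermitian_pos_def n I Q" and NQ: "N \<star>\<^bsub>n,I\<^esub> Q = id_tensor n I"
    using hermitian_pos_def_inverse[OF N] by blast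
  note mem [simp] = A M[THEN hermitian_pos_def_in_tensors] N[THEN hermitian_pos_def_in_tensors]
    Q[THEN hermitian_pos_def_in_tensors]
  note herm = M[THEN hermitian_pos_def_conj_transpose] N[THEN hermitian_pos_def_conj_transpose]
    Q[THEN hermitian_pos_def_conj_transpose]
  note AH = conj_transpose_in_tensors[OF A]
  have NQ_left: "N \<star>\<^bsub>n,I\<^esub> (Q \<star>\<^bsub>n,I\<^esub> Z) = Z" if "Z \<in> tensors n I" for Z
    using that by (simp add: NQ flip: einstein_prod_assoc)
  \<comment> \<open>\<open>?T\<close> begins with the Gram product \<open>A\<^sup>H M A\<close> and
    ends with \<open>A Q A\<^sup>H\<close>, the two overlapping in \<open>A\<close>; this allows
    cancellation from either side.\<close>
  let ?T = "A\<^sup>H \<star>\<^bsub>n,I\<^esub> M \<star>\<^bsub>n,I\<^esub> A \<star>\<^bsub>n,I\<^esub> Q \<star>\<^bsub>n,I\<^esub> A\<^sup>H"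
  obtain G where G [simp]: "G \<in> tensors n I" and TGT: "?T \<star>\<^bsub>n,I\<^esub> (G \<star>\<^bsub>n,I\<^esub> ?T) = ?T"
    by (rule inner_inverse_exists[of ?T n I]) auto
  define X where "X = Q \<star>\<^bsub>n,I\<^esub> A\<^sup>H \<star>\<^bsub>n,I\<^esub> G \<star>\<^bsub>n,I\<^esub> A\<^sup>H \<star>\<^bsub>n,I\<^esub> M"
  have X [simp]: "X \<in> tensors n I"
    by (simp add: X_def)

  \<comment> \<open>From \<open>T G T = T\<close>, first \<open>A\<^sup>H M\<close> and then
    \<open>A Q\<close> is cancelled on the left. The identity tensor below only supplies the factor
    that the cancellation rule expects.\<close>
  have "A \<star>\<^bsub>n,I\<^esub> (Q \<star>\<^bsub>n,I\<^esub> A\<^sup>H \<star>\<^bsub>n,I\<^esub> G \<star>\<^bsub>n,I\<^esub> ?T) = A \<star>\<^bsub>n,I\<^esub> (Q \<star>\<^bsub>n,I\<^esub> A\<^sup>H)"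
    by (rule weighted_gram_cancel_left[OF M A]) (use TGT in \<open>simp_all add: einstein_prod_assoc\<close>)
  hence "A\<^sup>H \<star>\<^bsub>n,I\<^esub> (G \<star>\<^bsub>n,I\<^esub> ?T) = A\<^sup>H \<star>\<^bsub>n,I\<^esub> id_tensor n I"
    by (intro weighted_gram_cancel_left[OF Q AH]) (simp_all add: einstein_prod_assoc)
  hence XAQ: "X \<star>\<^bsub>n,I\<^esub> (A \<star>\<^bsub>n,I\<^esub> (Q \<star>\<^bsub>n,I\<^esub> A\<^sup>H)) = Q \<star>\<^bsub>n,I\<^esub> A\<^sup>H"
    by (simp add: X_def einstein_prod_assoc)

  \<comment> \<open>The mirror image: \<open>Q A\<^sup>H\<close> and then \<open>M A\<close> is
    cancelled on the right.\<close>
  have "(?T \<star>\<^bsub>n,I\<^esub> G \<star>\<^bsub>n,I\<^esub> A\<^sup>H \<star>\<^bsub>n,I\<^esub> M) \<star>\<^bsub>n,I\<^esub> A = (A\<^sup>H \<star>\<^bsub>n,I\<^esub> M) \<star>\<^bsub>n,I\<^esub> A"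
    by (rule weighted_gram_cancel_right[OF Q A]) (use TGT in \<open>simp_all add: einstein_prod_assoc\<close>)
  hence "(?T \<star>\<^bsub>n,I\<^esub> G) \<star>\<^bsub>n,I\<^esub> A\<^sup>H = id_tensor n I \<star>\<^bsub>n,I\<^esub> A\<^sup>H"
    by (intro weighted_gram_cancel_right[OF M AH]) (simp_all add: einstein_prod_assoc)
  hence "?T \<star>\<^bsub>n,I\<^esub> G \<star>\<^bsub>n,I\<^esub> A\<^sup>H \<star>\<^bsub>n,I\<^esub> M = A\<^sup>H \<star>\<^bsub>n,I\<^esub> M"
    by simp
  hence MAX: "A\<^sup>H \<star>\<^bsub>n,I\<^esub> (M \<star>\<^bsub>n,I\<^esub> (A \<star>\<^bsub>n,I\<^esub> X)) = A\<^sup>H \<star>\<^bsub>n,I\<^esub> M"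
    by (simp add: X_def einstein_prod_assoc)

  have "is_weighted_MP_inverse n I M N A X"
    unfolding is_weighted_MP_inverse_def
  proof (intro conjI)
    have "A \<star>\<^bsub>n,I\<^esub> (X \<star>\<^bsub>n,I\<^esub> A) = A \<star>\<^bsub>n,I\<^esub> id_tensor n I"
    proof (rule weighted_gram_cancel_left[OF M A])
      show "A\<^sup>H \<star>\<^bsub>n,I\<^esub> (M \<star>\<^bsub>n,I\<^esub> (A \<star>\<^bsub>n,I\<^esub> (X \<star>\<^bsub>n,I\<^esub> A)))
          = A\<^sup>H \<star>\<^bsub>n,I\<^esub> (M \<star>\<^bsub>n,I\<^esub> (A \<star>\<^bsub>n,I\<^esub> id_tensor n I))"
        using arg_cong[OF MAX, of "\<lambda>Z. Z \<star>\<^bsub>n,I\<^esub> A"] by (simp add: einstein_prod_assoc)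
    qed simp_all
    thus "A \<star>\<^bsub>n,I\<^esub> X \<star>\<^bsub>n,I\<^esub> A = A"
      by (simp add: einstein_prod_assoc)
    show "X \<star>\<^bsub>n,I\<^esub> A \<star>\<^bsub>n,I\<^esub> X = X"
      \<comment> \<open>The added right factor completes \<open>Q A\<^sup>H\<close> to
        \<open>X\<close>.\<close>
      using arg_cong[OF XAQ, of "\<lambda>Z. Z \<star>\<^bsub>n,I\<^esub> (G \<star>\<^bsub>n,I\<^esub> (A\<^sup>H \<star>\<^bsub>n,I\<^esub> M))"]
      by (simp add: X_def einstein_prod_assoc)
    \<comment> \<open>The form \<open>(A X)\<^sup>H M (A X)\<close> is visibly Hermitian, and
      \<open>MAX\<close> collapses it to \<open>(M A X)\<^sup>H\<close>.\<close>
    have "(X\<^sup>H \<star>\<^bsub>n,I\<^esub> (A\<^sup>H \<star>\<^bsub>n,I\<^esub> (M \<star>\<^bsub>n,I\<^esub> (A \<star>\<^bsub>n,I\<^esub> X))))\<^sup>H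
        = X\<^sup>H \<star>\<^bsub>n,I\<^esub> (A\<^sup>H \<star>\<^bsub>n,I\<^esub> (M \<star>\<^bsub>n,I\<^esub> (A \<star>\<^bsub>n,I\<^esub> X)))"
      by (simp add: conj_transpose_einstein_prod einstein_prod_assoc herm)
    hence "(X\<^sup>H \<star>\<^bsub>n,I\<^esub> (A\<^sup>H \<star>\<^bsub>n,I\<^esub> M))\<^sup>H = X\<^sup>H \<star>\<^bsub>n,I\<^esub> (A\<^sup>H \<star>\<^bsub>n,I\<^esub> M)"
      by (simp only: MAX)
    thus "(M \<star>\<^bsub>n,I\<^esub> A \<star>\<^bsub>n,I\<^esub> X)\<^sup>H = M \<star>\<^bsub>n,I\<^esub> A \<star>\<^bsub>n,I\<^esub> X"
      by (simp add: conj_transpose_einstein_prod einstein_prod_assoc herm)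
    \<comment> \<open>Likewise \<open>(N X A) Q (N X A)\<^sup>H\<close> is Hermitian, and
      \<open>XAQ\<close> with \<open>N Q\<close> the identity collapses it to
      \<open>(N X A)\<^sup>H\<close>.\<close>
    have L: "N \<star>\<^bsub>n,I\<^esub> (X \<star>\<^bsub>n,I\<^esub> (A \<star>\<^bsub>n,I\<^esub> (Q \<star>\<^bsub>n,I\<^esub> (A\<^sup>H \<star>\<^bsub>n,I\<^esub> (X\<^sup>H \<star>\<^bsub>n,I\<^esub> N)))))
        = A\<^sup>H \<star>\<^bsub>n,I\<^esub> (X\<^sup>H \<star>\<^bsub>n,I\<^esub> N)" (is "?L = ?R")
      using arg_cong[OF XAQ, of "\<lambda>Z. N \<star>\<^bsub>n,I\<^esub> (Z \<star>\<^bsub>n,I\<^esub> (X\<^sup>H \<star>\<^bsub>n,I\<^esub> N))"]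
      by (simp add: einstein_prod_assoc NQ_left)
    have "?L\<^sup>H = ?L"
      by (simp add: conj_transpose_einstein_prod einstein_prod_assoc herm)
    hence "?R\<^sup>H = ?R"
      by (simp only: L)
    thus "(N \<star>\<^bsub>n,I\<^esub> X \<star>\<^bsub>n,I\<^esub> A)\<^sup>H = N \<star>\<^bsub>n,I\<^esub> X \<star>\<^bsub>n,I\<^esub> A"
      by (simp add: conj_transpose_einstein_prod einstein_prod_assoc herm)
  qed simp
  thus thesis
    by (rule that)
qed

section \<open>Uniqueness of the weighted inverse\<close>

lemma hermitian_pos_def_cancel_left:
  assumes P: "hermitian_pos_def n I P" and ZW: "Z \<in> tensors n I" "W \<in> tensors n I"
    and eq: "P \<star>\<^bsub>n,I\<^esub> Z = P \<star>\<^bsub>n,I\<^esub> W"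
  shows "Z = W"
proof -
  obtain Q where QP: "Q \<star>\<^bsub>n,I\<^esub> P = id_tensor n I"
    using hermitian_pos_def_inverse[OF P] by blast
  have "Q \<star>\<^bsub>n,I\<^esub> (P \<star>\<^bsub>n,I\<^esub> Z) = Q \<star>\<^bsub>n,I\<^esub> (P \<star>\<^bsub>n,I\<^esub> W)"
    by (simp add: eq)
  thus ?thesis
    by (simp add: QP ZW flip: einstein_prod_assoc)
qed

text \<open>In the inner product of \<open>P\<close>, \<open>E\<close> and \<open>F\<close> are
  orthogonal projections with the same range: the product equations give idempotence and both
  inclusions.\<close>

lemma weighted_projection_unique_range:
  assumes P: "hermitian_pos_def n I P" and EF: "E \<in> tensors n I" "F \<in> tensors n I"
    and E: "(P \<star>\<^bsub>n,I\<^esub> E)\<^sup>H = P \<star>\<^bsub>n,I\<^esub> E" and F: "(P \<star>\<^bsub>n,I\<^esub> F)\<^sup>H = P \<star>\<^bsub>n,I\<^esub> F"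
    and FE: "F \<star>\<^bsub>n,I\<^esub> E = E" and EF': "E \<star>\<^bsub>n,I\<^esub> F = F"
  shows "E = F"
proof (rule hermitian_pos_def_cancel_left[OF P EF])
  have E': "E\<^sup>H \<star>\<^bsub>n,I\<^esub> P = P \<star>\<^bsub>n,I\<^esub> E" and F': "F\<^sup>H \<star>\<^bsub>n,I\<^esub> P = P \<star>\<^bsub>n,I\<^esub> F"
    using E F by (simp_all add: conj_transpose_einstein_prod hermitian_pos_def_conj_transpose[OF P])
  have "P \<star>\<^bsub>n,I\<^esub> E = F\<^sup>H \<star>\<^bsub>n,I\<^esub> (E\<^sup>H \<star>\<^bsub>n,I\<^esub> P)"
    by (metis E' F' FE einstein_prod_assoc)
  also have "\<dots> = (E \<star>\<^bsub>n,I\<^esub> F)\<^sup>H \<star>\<^bsub>n,I\<^esub> P"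
    by (simp add: conj_transpose_einstein_prod einstein_prod_assoc)
  also have "\<dots> = P \<star>\<^bsub>n,I\<^esub> F"
    by (simp add: EF' F')
  finally show "P \<star>\<^bsub>n,I\<^esub> E = P \<star>\<^bsub>n,I\<^esub> F" .
qed

text \<open>The companion for orthogonal projections with the same kernel.\<close>

lemma weighted_projection_unique_kernel:
  assumes P: "hermitian_pos_def n I P" and EF: "E \<in> tensors n I" "F \<in> tensors n I"
    and E: "(P \<star>\<^bsub>n,I\<^esub> E)\<^sup>H = P \<star>\<^bsub>n,I\<^esub> E" and F: "(P \<star>\<^bsub>n,I\<^esub> F)\<^sup>H = P \<star>\<^bsub>n,I\<^esub> F"
    and EF': "E \<star>\<^bsub>n,I\<^esub> F = E" and FE: "F \<star>\<^bsub>n,I\<^esub> E = F"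
  shows "E = F"
proof (rule hermitian_pos_def_cancel_left[OF P EF])
  have E': "E\<^sup>H \<star>\<^bsub>n,I\<^esub> P = P \<star>\<^bsub>n,I\<^esub> E" and F': "F\<^sup>H \<star>\<^bsub>n,I\<^esub> P = P \<star>\<^bsub>n,I\<^esub> F"
    using E F by (simp_all add: conj_transpose_einstein_prod hermitian_pos_def_conj_transpose[OF P])
  have "P \<star>\<^bsub>n,I\<^esub> E = E\<^sup>H \<star>\<^bsub>n,I\<^esub> (F\<^sup>H \<star>\<^bsub>n,I\<^esub> P)"
    by (metis E' F' EF' einstein_prod_assoc)
  also have "\<dots> = (F \<star>\<^bsub>n,I\<^esub> E)\<^sup>H \<star>\<^bsub>n,I\<^esub> P"
    by (simp add: conj_transpose_einstein_prod einstein_prod_assoc)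
  also have "\<dots> = P \<star>\<^bsub>n,I\<^esub> F"
    by (simp add: FE F')
  finally show "P \<star>\<^bsub>n,I\<^esub> E = P \<star>\<^bsub>n,I\<^esub> F" .
qed

text \<open>\<open>A X\<close> and \<open>A Y\<close> are \<open>M\<close>-orthogonal projections
  onto the range of \<open>A\<close>, while \<open>X A\<close> and \<open>Y A\<close> are
  \<open>N\<close>-orthogonal projections along its kernel. Equality of both pairs gives
  \<open>X = X A X = X A Y = Y A Y = Y\<close>.\<close>

lemma weighted_MP_inverse_unique:
  assumes M: "hermitian_pos_def n I M" and N: "hermitian_pos_def n I N"
    and A: "A \<in> tensors n I"
    and X: "is_weighted_MP_inverse n I M N A X" and Y: "is_weighted_MP_inverse n I M N A Y"
  shows "X = Y"
proof -
  note X' = X[unfolded is_weighted_MP_inverse_def einstein_prod_assoc]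
  note Y' = Y[unfolded is_weighted_MP_inverse_def einstein_prod_assoc]
  have AYAX: "(A \<star>\<^bsub>n,I\<^esub> Y) \<star>\<^bsub>n,I\<^esub> (A \<star>\<^bsub>n,I\<^esub> X) = A \<star>\<^bsub>n,I\<^esub> X"
    and AXAY: "(A \<star>\<^bsub>n,I\<^esub> X) \<star>\<^bsub>n,I\<^esub> (A \<star>\<^bsub>n,I\<^esub> Y) = A \<star>\<^bsub>n,I\<^esub> Y"
    using X Y unfolding is_weighted_MP_inverse_def by (metis einstein_prod_assoc)+
  have AX: "A \<star>\<^bsub>n,I\<^esub> X = A \<star>\<^bsub>n,I\<^esub> Y"
    by (rule weighted_projection_unique_range[OF M])
       (use A X' Y' AYAX AXAY in simp_all)
  have XA: "X \<star>\<^bsub>n,I\<^esub> A = Y \<star>\<^bsub>n,I\<^esub> A"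
    by (rule weighted_projection_unique_kernel[OF N])
       (use A X' Y' in \<open>simp_all add: einstein_prod_assoc\<close>)
  have "X = X \<star>\<^bsub>n,I\<^esub> (A \<star>\<^bsub>n,I\<^esub> Y)"
    using X' AX by simp
  also have "\<dots> = Y \<star>\<^bsub>n,I\<^esub> (A \<star>\<^bsub>n,I\<^esub> Y)"
    by (simp add: XA flip: einstein_prod_assoc)
  also have "\<dots> = Y"
    using Y' by simp
  finally show ?thesis .
qed

lemma weighted_MP_inverse_eqI:
  assumes "hermitian_pos_def n I M" and "hermitian_pos_def n I N" and "A \<in> tensors n I"
    and "is_weighted_MP_inverse n I M N A X"
  shows "A\<^sup>\<dagger>\<^bsub>n,I,M,N\<^esub> = X"
  unfolding weighted_MP_inverse_def
  using assms weighted_MP_inverse_unique by (intro the_equality) blast+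

text \<open>Existence and uniqueness together discharge the definite description, so that the
  Penrose equations become available for it.\<close>

lemma is_weighted_MP_inverse_weighted_MP_inverse:
  assumes "hermitian_pos_def n I M" and "hermitian_pos_def n I N" and "A \<in> tensors n I"
  shows "is_weighted_MP_inverse n I M N A (A\<^sup>\<dagger>\<^bsub>n,I,M,N\<^esub>)"
proof -
  obtain X where "is_weighted_MP_inverse n I M N A X"
    using weighted_MP_inverse_exists[OF assms] .
  thus ?thesis
    by (simp add: weighted_MP_inverse_eqI[OF assms])
qed

section \<open>The reverse order law\<close>

theorem theorem4p4:
  fixes n :: nat and I :: "nat \<Rightarrow> nat" and A B M N :: tensor
  assumes "A \<in> tensors n I" and "B \<in> tensors n I"
    and "M \<in> tensors n I" and "N \<in> tensors n I"
    and "hermitian_pos_def n I M" and "hermitian_pos_def n I N"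
    and "M \<star>\<^bsub>n,I\<^esub> A\<^sup>\<dagger>\<^bsub>n,I,M,N\<^esub> = (M \<star>\<^bsub>n,I\<^esub> A)\<^sup>H"
    and "B \<star>\<^bsub>n,I\<^esub> (A\<^sup>\<dagger>\<^bsub>n,I,M,N\<^esub> \<star>\<^bsub>n,I\<^esub> A) = (A\<^sup>\<dagger>\<^bsub>n,I,M,N\<^esub> \<star>\<^bsub>n,I\<^esub> A) \<star>\<^bsub>n,I\<^esub> B"
    and "B\<^sup>\<dagger>\<^bsub>n,I,M,N\<^esub> \<star>\<^bsub>n,I\<^esub> (A\<^sup>\<dagger>\<^bsub>n,I,M,N\<^esub> \<star>\<^bsub>n,I\<^esub> A)
         = (A\<^sup>\<dagger>\<^bsub>n,I,M,N\<^esub> \<star>\<^bsub>n,I\<^esub> A) \<star>\<^bsub>n,I\<^esub> B\<^sup>\<dagger>\<^bsub>n,I,M,N\<^esub>"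
  shows "(A \<star>\<^bsub>n,I\<^esub> B)\<^sup>\<dagger>\<^bsub>n,I,M,N\<^esub> = B\<^sup>\<dagger>\<^bsub>n,I,M,N\<^esub> \<star>\<^bsub>n,I\<^esub> A\<^sup>\<dagger>\<^bsub>n,I,M,N\<^esub>"
proof -
  note A = assms(1) and B = assms(2) and M = assms(5) and N = assms(6)
  define X where "X = A\<^sup>\<dagger>\<^bsub>n,I,M,N\<^esub>"
  define Y where "Y = B\<^sup>\<dagger>\<^bsub>n,I,M,N\<^esub>"
  \<comment> \<open>\<open>P\<close> and \<open>Q\<close> are projections self-adjoint for
    \<open>N\<close>, and \<open>R\<close> is one self-adjoint for \<open>M\<close>.\<close>
  define P where "P = X \<star>\<^bsub>n,I\<^esub> A"
  define Q where "Q = Y \<star>\<^bsub>n,I\<^esub> B"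
  define R where "R = B \<star>\<^bsub>n,I\<^esub> Y"
  note herm = hermitian_pos_def_conj_transpose[OF M] hermitian_pos_def_conj_transpose[OF N]
  have X: "is_weighted_MP_inverse n I M N A X" and Y: "is_weighted_MP_inverse n I M N B Y"
    unfolding X_def Y_def
    by (fact is_weighted_MP_inverse_weighted_MP_inverse[OF M N A]
        is_weighted_MP_inverse_weighted_MP_inverse[OF M N B])+
  have Xt [simp]: "X \<in> tensors n I" and Yt [simp]: "Y \<in> tensors n I"
    using X Y by (auto simp: is_weighted_MP_inverse_def)
  have AP: "A \<star>\<^bsub>n,I\<^esub> P = A" and PX: "P \<star>\<^bsub>n,I\<^esub> X = X"
    and BQ: "B \<star>\<^bsub>n,I\<^esub> Q = B" and QY: "Q \<star>\<^bsub>n,I\<^esub> Y = Y"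
    using X Y by (simp_all add: is_weighted_MP_inverse_def P_def Q_def einstein_prod_assoc)
  have P: "P\<^sup>H \<star>\<^bsub>n,I\<^esub> N = N \<star>\<^bsub>n,I\<^esub> P" and Q: "Q\<^sup>H \<star>\<^bsub>n,I\<^esub> N = N \<star>\<^bsub>n,I\<^esub> Q"
    and R: "R\<^sup>H \<star>\<^bsub>n,I\<^esub> M = M \<star>\<^bsub>n,I\<^esub> R"
    using X Y by (simp_all add: is_weighted_MP_inverse_def P_def Q_def R_def
        conj_transpose_einstein_prod einstein_prod_assoc herm)
  have BP: "B \<star>\<^bsub>n,I\<^esub> P = P \<star>\<^bsub>n,I\<^esub> B" and YP: "Y \<star>\<^bsub>n,I\<^esub> P = P \<star>\<^bsub>n,I\<^esub> Y"
    using assms(8,9) by (simp_all add: P_def X_def Y_def)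
  have QP: "Q \<star>\<^bsub>n,I\<^esub> P = P \<star>\<^bsub>n,I\<^esub> Q"
    by (metis Q_def BP YP einstein_prod_assoc)
  have MX: "M \<star>\<^bsub>n,I\<^esub> X = A\<^sup>H \<star>\<^bsub>n,I\<^esub> M"
    using assms(7) by (simp add: X_def conj_transpose_einstein_prod herm)
  hence XM: "X\<^sup>H \<star>\<^bsub>n,I\<^esub> M = M \<star>\<^bsub>n,I\<^esub> A"
    by (metis conj_transpose_conj_transpose conj_transpose_einstein_prod herm(1))

  \<comment> \<open>The inner \<open>X A\<close> is \<open>P\<close>, which moves to the left past
    \<open>Y\<close>.\<close>
  have left: "Y \<star>\<^bsub>n,I\<^esub> X \<star>\<^bsub>n,I\<^esub> (A \<star>\<^bsub>n,I\<^esub> B) = P \<star>\<^bsub>n,I\<^esub> Q"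
    by (metis P_def Q_def YP einstein_prod_assoc)
  have right: "A \<star>\<^bsub>n,I\<^esub> B \<star>\<^bsub>n,I\<^esub> (Y \<star>\<^bsub>n,I\<^esub> X) = A \<star>\<^bsub>n,I\<^esub> R \<star>\<^bsub>n,I\<^esub> X"
    by (simp add: R_def einstein_prod_assoc)
  have "is_weighted_MP_inverse n I M N (A \<star>\<^bsub>n,I\<^esub> B) (Y \<star>\<^bsub>n,I\<^esub> X)"
    unfolding is_weighted_MP_inverse_def
  proof (intro conjI)
    have "A \<star>\<^bsub>n,I\<^esub> B \<star>\<^bsub>n,I\<^esub> (Y \<star>\<^bsub>n,I\<^esub> X) \<star>\<^bsub>n,I\<^esub> (A \<star>\<^bsub>n,I\<^esub> B) = A \<star>\<^bsub>n,I\<^esub> B \<star>\<^bsub>n,I\<^esub> (P \<star>\<^bsub>n,I\<^esub> Q)"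
      by (metis left einstein_prod_assoc)
    also have "\<dots> = A \<star>\<^bsub>n,I\<^esub> P \<star>\<^bsub>n,I\<^esub> (B \<star>\<^bsub>n,I\<^esub> Q)"
      by (metis BP einstein_prod_assoc)
    also have "\<dots> = A \<star>\<^bsub>n,I\<^esub> B"
      by (simp add: AP BQ)
    finally show "A \<star>\<^bsub>n,I\<^esub> B \<star>\<^bsub>n,I\<^esub> (Y \<star>\<^bsub>n,I\<^esub> X) \<star>\<^bsub>n,I\<^esub> (A \<star>\<^bsub>n,I\<^esub> B) = A \<star>\<^bsub>n,I\<^esub> B" .
    have "Y \<star>\<^bsub>n,I\<^esub> X \<star>\<^bsub>n,I\<^esub> (A \<star>\<^bsub>n,I\<^esub> B) \<star>\<^bsub>n,I\<^esub> (Y \<star>\<^bsub>n,I\<^esub> X) = P \<star>\<^bsub>n,I\<^esub> (Q \<star>\<^bsub>n,I\<^esub> Y) \<star>\<^bsub>n,I\<^esub> X"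
      unfolding left by (simp only: einstein_prod_assoc)
    also have "\<dots> = Y \<star>\<^bsub>n,I\<^esub> (P \<star>\<^bsub>n,I\<^esub> X)"
      by (metis QY YP einstein_prod_assoc)
    finally show "Y \<star>\<^bsub>n,I\<^esub> X \<star>\<^bsub>n,I\<^esub> (A \<star>\<^bsub>n,I\<^esub> B) \<star>\<^bsub>n,I\<^esub> (Y \<star>\<^bsub>n,I\<^esub> X) = Y \<star>\<^bsub>n,I\<^esub> X"
      by (simp only: PX)
    have "(M \<star>\<^bsub>n,I\<^esub> (A \<star>\<^bsub>n,I\<^esub> R \<star>\<^bsub>n,I\<^esub> X))\<^sup>H = X\<^sup>H \<star>\<^bsub>n,I\<^esub> (R\<^sup>H \<star>\<^bsub>n,I\<^esub> (A\<^sup>H \<star>\<^bsub>n,I\<^esub> M))"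
      by (simp add: conj_transpose_einstein_prod einstein_prod_assoc herm)
    also have "\<dots> = M \<star>\<^bsub>n,I\<^esub> (A \<star>\<^bsub>n,I\<^esub> R \<star>\<^bsub>n,I\<^esub> X)"
      \<comment> \<open>\<open>M\<close> travels to the left: \<open>A\<^sup>H M = M X\<close>, then
        \<open>R\<^sup>H M = M R\<close>, and finally \<open>X\<^sup>H M = M A\<close>.\<close>
      by (metis MX R XM einstein_prod_assoc)
    finally show "(M \<star>\<^bsub>n,I\<^esub> (A \<star>\<^bsub>n,I\<^esub> B) \<star>\<^bsub>n,I\<^esub> (Y \<star>\<^bsub>n,I\<^esub> X))\<^sup>H
        = M \<star>\<^bsub>n,I\<^esub> (A \<star>\<^bsub>n,I\<^esub> B) \<star>\<^bsub>n,I\<^esub> (Y \<star>\<^bsub>n,I\<^esub> X)"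
      by (metis right einstein_prod_assoc)
    have "(N \<star>\<^bsub>n,I\<^esub> (P \<star>\<^bsub>n,I\<^esub> Q))\<^sup>H = Q\<^sup>H \<star>\<^bsub>n,I\<^esub> (P\<^sup>H \<star>\<^bsub>n,I\<^esub> N)"
      by (simp add: conj_transpose_einstein_prod einstein_prod_assoc herm)
    also have "\<dots> = N \<star>\<^bsub>n,I\<^esub> (P \<star>\<^bsub>n,I\<^esub> Q)"
      \<comment> \<open>Moving \<open>N\<close> to the left yields \<open>N Q P\<close>; commutation
        of \<open>P\<close> and \<open>Q\<close> restores the order.\<close>
      by (metis P Q QP einstein_prod_assoc)
    finally show "(N \<star>\<^bsub>n,I\<^esub> (Y \<star>\<^bsub>n,I\<^esub> X) \<star>\<^bsub>n,I\<^esub> (A \<star>\<^bsub>n,I\<^esub> B))\<^sup>H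
        = N \<star>\<^bsub>n,I\<^esub> (Y \<star>\<^bsub>n,I\<^esub> X) \<star>\<^bsub>n,I\<^esub> (A \<star>\<^bsub>n,I\<^esub> B)"
      by (metis left einstein_prod_assoc)
  qed simp
  with A B M N show ?thesis
    by (simp add: weighted_MP_inverse_eqI X_def Y_def)
qed

end
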